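(* Let $c\in\mathbb{C}$ and consider the sequence of hypergeometric polynomials $$P(k)={}_2F_1\!\left(-\tfrac{k}{2},\,-\tfrac{k-1}{2};\;1-k-c;\;z\right).$$ Suppose that for a positive integer $k$ we have $(c)_k\neq 0$ and $(2c)_k\neq 0$. Then: (1) the polynomials $P(k)$ and $P(k-1)$ (in the variable $z$) do not have common roots; (2) the polynomial $P(k)$ has $\lfloor k/2\rfloor$ distinct roots; (3) $z=1$ is not a root of $P(k)$.
   Context: $(\alpha)_j=\alpha(\alpha+1)\cdots(\alpha+j-1)$ denotes the Pochhammer symbol, with $(\alpha)_0=1$. For a non-negative integer $k$, the expression ${}_2F_1(-\frac{k}{2},-\frac{k-1}{2};C;z)$ denotes the terminating sum $$\sum_{j=0}^{\lfloor k/2\rfloor}\frac{(-\frac{k}{2})_j\,(-\frac{k-1}{2})_j}{(C)_j\,j!}\,z^j ,$$ a polynomial in $z$; this finite-sum interpretation is also used when $C$ is an integer with $C\le -k$. In particular $P(0)=1$. Roots are taken in $\mathbb{C}$. *)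

theory Defs
  imports Complex_Main "HOL-Computational_Algebra.Polynomial"
begin

(* The sum stops at j = k div 2 by definition, not because the numerator vanishes from
   there on, so no condition on C is imposed beyond the denominators (C)_j, j <= k div 2;
   in particular C may be an integer with C <= -k. *)
definition hyp2F1_poly :: "nat \<Rightarrow> complex \<Rightarrow> complex poly" where
  "hyp2F1_poly k C =
     (\<Sum>j\<le>k div 2.
        monom (pochhammer (- (of_nat k / 2)) j * pochhammer (- ((of_nat k - 1) / 2)) j
                 / (pochhammer C j * fact j)) j)"

definition P :: "complex \<Rightarrow> nat \<Rightarrow> complex poly" where
  "P c k = hyp2F1_poly k (1 - of_nat k - c)"

end

theory Submission
  imports Defs "HOL-Computational_Algebra.Fundamental_Theorem_Algebra"
begin

text \<open>
  Multiplied by \<open>(c)\<^sub>k / k!\<close>, the polynomial \<open>P(k)\<close> becomes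
  \<open>G\<^sub>k(z) = (\<Sum>j. (- 1/4)\<^sup>j (c)\<^bsub>k-j\<^esub> / (j! (k - 2 j)!) z\<^sup>j)\<close>,
  which is the Gegenbauer polynomial read backwards:
  \<open>C\<^sub>k(x) = (2 x)\<^sup>k G\<^sub>k(1 / x\<^sup>2)\<close> for the parameter \<open>c\<close>. The hypothesis \<open>(c)\<^sub>k \<noteq> 0\<close> makes
  the factor invertible and the coefficient of \<open>z\<^sup>j\<close> nonzero for every \<open>j \<le> k div 2\<close>, so
  \<open>G\<^sub>k\<close> has the same roots as \<open>P(k)\<close> and its degree is \<open>k div 2\<close>.

  Two classical Gegenbauer identities, rewritten in \<open>z\<close>, carry the proof:
  the three-term recurrence (\<open>rev_gegenbauer_recurrence\<close>)
  \<open>(k + 2) G\<^bsub>k+2\<^esub> = (k + 1 + c) G\<^bsub>k+1\<^esub> - (k + 2 c) (z / 4) G\<^sub>k\<close>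
  and the first-order relation (\<open>rev_gegenbauer_pderiv\<close>)
  \<open>(k + 1) G\<^bsub>k+1\<^esub> - 2 (z - 1) G'\<^bsub>k+1\<^esub> = ((k + 2 c) / 2) G\<^sub>k\<close>.
  As \<open>(2 c)\<^sub>k \<noteq> 0\<close>, the factors \<open>i + 2 c\<close> with \<open>i < k\<close> do not vanish. Hence a common root of two
  consecutive polynomials, which is not \<open>0\<close> because \<open>G\<^sub>k(0) = (c)\<^sub>k / k!\<close>, descends
  through the recurrence to a root of \<open>G\<^sub>0 = 1\<close>, which is absurd. A multiple root of \<open>G\<^sub>k\<close> would by
  the first-order relation be a root of \<open>G\<^bsub>k-1\<^esub>\<close> too, so all roots are simple and their number is
  the degree. Finally the recurrence at \<open>z = 1\<close> has the solution
  \<open>G\<^sub>k(1) = (2 c)\<^sub>k / (2\<^sup>k k!)\<close>, which is nonzero.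
\<close>

section \<open>Reversed Gegenbauer polynomials\<close>

definition rev_gegenbauer_coeff :: "'a::field_char_0 \<Rightarrow> nat \<Rightarrow> nat \<Rightarrow> 'a" where
  "rev_gegenbauer_coeff c k j =
     (if 2 * j \<le> k then (- 1 / 4) ^ j * pochhammer c (k - j) / (fact j * fact (k - 2 * j)) else 0)"

definition rev_gegenbauer :: "'a::field_char_0 \<Rightarrow> nat \<Rightarrow> 'a poly" where
  "rev_gegenbauer c k = (\<Sum>j\<le>k div 2. monom (rev_gegenbauer_coeff c k j) j)"

lemma coeff_rev_gegenbauer [simp]:
  "coeff (rev_gegenbauer c k) j = rev_gegenbauer_coeff c k j"
proof -
  have "coeff (rev_gegenbauer c k) j =
      (\<Sum>i\<le>k div 2. if i = j then rev_gegenbauer_coeff c k j else 0)"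
    by (simp add: rev_gegenbauer_def coeff_sum coeff_monom if_distrib cong: if_cong)
  also have "\<dots> = (if j \<le> k div 2 then rev_gegenbauer_coeff c k j else 0)"
    by (simp add: sum.delta')
  also have "\<dots> = rev_gegenbauer_coeff c k j"
    by (auto simp: rev_gegenbauer_coeff_def)
  finally show ?thesis .
qed

lemma rev_gegenbauer_0 [simp]: "rev_gegenbauer c 0 = 1"
  by (simp add: rev_gegenbauer_def rev_gegenbauer_coeff_def)

lemma rev_gegenbauer_1 [simp]: "rev_gegenbauer c (Suc 0) = [:c:]"
  by (simp add: rev_gegenbauer_def rev_gegenbauer_coeff_def monom_0)

lemma poly_rev_gegenbauer_at_0: "poly (rev_gegenbauer c k) 0 = pochhammer c k / fact k"
  by (simp add: poly_0_coeff_0 rev_gegenbauer_coeff_def)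

section \<open>Relation to the hypergeometric polynomials\<close>

text \<open>By the duplication formula the two numerators merge into \<open>(- k)\<^bsub>2 j\<^esub> / 4\<^sup>j\<close>, a falling
  factorial of \<open>k\<close>.\<close>

lemma pochhammer_neg_half_times:
  assumes "2 * j \<le> k"
  shows "pochhammer (- (of_nat k / 2)) j * pochhammer (- ((of_nat k - 1) / 2)) j
           = (fact k / (4 ^ j * fact (k - 2 * j)) :: 'a::field_char_0)"
proof -
  have double: "pochhammer (- of_nat k :: 'a) (2 * j) =
      4 ^ j * (pochhammer (- (of_nat k / 2)) j * pochhammer (- ((of_nat k - 1) / 2)) j)"
  proof -
    have "- (of_nat k / 2) + 1 / 2 = (- ((of_nat k - 1) / 2) :: 'a)"
      by (simp add: field_simps)
    moreover have "(of_nat (2 ^ (2 * j)) :: 'a) = 4 ^ j"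
      by (simp add: power_mult)
    ultimately show ?thesis
      using pochhammer_double[of "- (of_nat k / 2) :: 'a" j] by (simp add: mult.assoc)
  qed
  have "pochhammer (- of_nat k :: 'a) (2 * j) = pochhammer (1 + of_nat (k - 2 * j)) (2 * j)"
    using assms by (simp add: pochhammer_minus of_nat_diff algebra_simps)
  moreover have "(fact k :: 'a) = fact (k - 2 * j) * pochhammer (1 + of_nat (k - 2 * j)) (2 * j)"
    using pochhammer_product[of "k - 2 * j" k "1 :: 'a"] assms by (simp add: pochhammer_fact)
  ultimately show ?thesis
    using double by (simp add: field_simps)
qed

text \<open>Reversing the \<open>j\<close> factors of \<open>(1 - k - c)\<^sub>j\<close> gives the last \<open>j\<close> factors of \<open>(c)\<^sub>k\<close> up to
  sign. In this product form \<open>(c)\<^sub>k \<noteq> 0\<close> also shows that the hypergeometric denominators do not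
  vanish.\<close>

lemma pochhammer_reflected_denominator:
  fixes c :: "'a::field_char_0"
  assumes "j \<le> k"
  shows "pochhammer c k = (- 1) ^ j * pochhammer (1 - of_nat k - c) j * pochhammer c (k - j)"
proof -
  have "pochhammer (1 - of_nat k - c) j = (- 1) ^ j * pochhammer (c + of_nat (k - j)) j"
    using pochhammer_minus[of "c + of_nat k - 1" j] assms
    by (simp add: of_nat_diff algebra_simps)
  moreover have "pochhammer c k = pochhammer c (k - j) * pochhammer (c + of_nat (k - j)) j"
    using pochhammer_product[of "k - j" k c] assms by simp
  ultimately show ?thesis
    by (simp flip: power_mult_distrib)
qed

lemma P_eq_smult_rev_gegenbauer:
  assumes "pochhammer c k \<noteq> 0"
  shows "P c k = smult (fact k / pochhammer c k) (rev_gegenbauer c k)"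
proof -
  have "pochhammer (- (of_nat k / 2)) j * pochhammer (- ((of_nat k - 1) / 2)) j
            / (pochhammer (1 - of_nat k - c) j * fact j)
          = fact k / pochhammer c k * rev_gegenbauer_coeff c k j" if "j \<le> k div 2" for j
  proof -
    have j: "2 * j \<le> k" using that by simp
    have refl: "pochhammer c k = (- 1) ^ j * pochhammer (1 - of_nat k - c) j * pochhammer c (k - j)"
      using pochhammer_reflected_denominator[of j k c] j by simp
    have nz: "pochhammer (1 - of_nat k - c) j \<noteq> 0" "pochhammer c (k - j) \<noteq> 0"
      using assms unfolding refl by auto
    have sgn: "(- 1 / 4 :: complex) ^ j = (- 1) ^ j / 4 ^ j"
      by (rule power_divide)
    show ?thesis
      unfolding pochhammer_neg_half_times[OF j] rev_gegenbauer_coeff_def refl sgn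
      using nz j by (simp add: field_simps)
  qed
  then show ?thesis
    unfolding P_def hyp2F1_poly_def rev_gegenbauer_def
    by (intro poly_eqI) (simp add: coeff_sum sum_distrib_left if_distrib cong: sum.cong)
qed

lemma degree_rev_gegenbauer:
  assumes "pochhammer c k \<noteq> 0"
  shows "degree (rev_gegenbauer c k) = k div 2"
proof (rule antisym)
  show "degree (rev_gegenbauer c k) \<le> k div 2"
    by (rule degree_le) (auto simp: rev_gegenbauer_coeff_def)
  have "pochhammer c (k - k div 2) \<noteq> 0"
    using assms by (rule pochhammer_neq_0_mono) simp
  then show "k div 2 \<le> degree (rev_gegenbauer c k)"
    by (intro le_degree) (simp add: rev_gegenbauer_coeff_def)
qed

section \<open>The two Gegenbauer identities\<close>

lemma rev_gegenbauer_recurrence: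
  "smult (of_nat k + 2) (rev_gegenbauer c (Suc (Suc k))) =
     smult (of_nat k + 1 + c) (rev_gegenbauer c (Suc k))
     - smult ((of_nat k + 2 * c) / 4) (pCons 0 (rev_gegenbauer c k))"
proof (rule poly_eqI)
  fix j
  let ?g = "rev_gegenbauer_coeff c"
  have "(of_nat k + 2) * ?g (Suc (Suc k)) j =
      (of_nat k + 1 + c) * ?g (Suc k) j
      - (of_nat k + 2 * c) / 4 * (case j of 0 \<Rightarrow> 0 | Suc i \<Rightarrow> ?g k i)"
  proof (cases j)
    case 0
    have "(of_nat k + 2 :: 'a) \<noteq> 0"
      using of_nat_neq_0[of "Suc k", where 'a = 'a] by (simp add: add.commute)
    then show ?thesis
      using 0 by (simp add: rev_gegenbauer_coeff_def pochhammer_Suc divide_simps)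
        (simp add: algebra_simps)
  next
    case (Suc i)
    \<comment> \<open>The middle term vanishes when \<open>k = 2 i\<close>; for \<open>k > 2 i\<close> all three
      are polynomial multiples of the term \<open>a\<close> below.\<close>
    consider "k < 2 * i" | "k = 2 * i" | n where "k = 2 * i + Suc n"
      by (metis less_iff_Suc_add linorder_neqE_nat add_Suc_right)
    then show ?thesis
    proof cases
      case 1
      then show ?thesis using Suc by (simp add: rev_gegenbauer_coeff_def)
    next
      case 2
      have "(of_nat i + 1 :: 'a) \<noteq> 0"
        using of_nat_neq_0[of i, where 'a = 'a] by (simp add: add.commute)
      then show ?thesis
        using Suc 2 by (simp add: rev_gegenbauer_coeff_def pochhammer_Suc divide_simps)
          (simp add: algebra_simps)
    next
      case 3
      define a where
        "a = (- 1 / 4) ^ Suc i * pochhammer c (Suc (i + n)) / (fact (Suc i) * fact (Suc n))"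
      have idx: "Suc (Suc k) - Suc i = Suc (Suc (i + n))" "Suc k - Suc i = Suc (i + n)"
          "k - i = Suc (i + n)" "Suc (Suc k) - 2 * Suc i = Suc n" "Suc k - 2 * Suc i = n"
          "k - 2 * i = Suc n"
        using 3 by simp_all
      have g2: "?g (Suc (Suc k)) (Suc i) = (c + of_nat (Suc (i + n))) * a"
        unfolding rev_gegenbauer_coeff_def idx a_def pochhammer_Suc[of c "Suc (i + n)"]
        using 3 by simp
      have g1: "?g (Suc k) (Suc i) = of_nat (Suc n) * a"
        unfolding rev_gegenbauer_coeff_def idx a_def fact_Suc
        using 3 by (simp add: field_simps del: of_nat_Suc)
      have g0: "?g k i = - 4 * of_nat (Suc i) * a"
        unfolding rev_gegenbauer_coeff_def idx a_def fact_Suc power_Suc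
        using 3 by (simp add: field_simps del: of_nat_Suc)
      show ?thesis
        unfolding Suc nat.case g2 g1 g0 by (simp add: 3 field_simps)
    qed
  qed
  then show "coeff (smult (of_nat k + 2) (rev_gegenbauer c (Suc (Suc k)))) j =
      coeff (smult (of_nat k + 1 + c) (rev_gegenbauer c (Suc k))
     - smult ((of_nat k + 2 * c) / 4) (pCons 0 (rev_gegenbauer c k))) j"
    by (cases j) simp_all
qed

text \<open>This is \<open>(1 - x\<^sup>2) C'\<^sub>n = - n x C\<^sub>n + (n + 2 c - 1) C\<^bsub>n-1\<^esub>\<close> with \<open>n = k + 1\<close>, after the
  substitution \<open>z = 1 / x\<^sup>2\<close>.\<close>

lemma rev_gegenbauer_pderiv:
  "smult (of_nat (Suc k)) (rev_gegenbauer c (Suc k))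
     - smult 2 ([:- 1, 1:] * pderiv (rev_gegenbauer c (Suc k))) =
   smult ((of_nat k + 2 * c) / 2) (rev_gegenbauer c k)"
proof (rule poly_eqI)
  fix j
  let ?g = "rev_gegenbauer_coeff c"
  have key: "of_nat (Suc k) * ?g (Suc k) j - 2 * of_nat j * ?g (Suc k) j
      + 2 * of_nat (Suc j) * ?g (Suc k) (Suc j) = (of_nat k + 2 * c) / 2 * ?g k j"
  proof -
    \<comment> \<open>For \<open>k + 1 = 2 j\<close> and \<open>k = 2 j\<close> the coefficient at \<open>j + 1\<close> is zero, and for \<open>k + 1 = 2 j\<close>
      the one on the right as well.\<close>
    consider "Suc k < 2 * j" | "Suc k = 2 * j" | "k = 2 * j" | n where "k = 2 * j + Suc n"
      by (metis less_iff_Suc_add linorder_neqE_nat add_Suc_right less_antisym not_less_eq)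
    then show ?thesis
    proof cases
      case 1
      then show ?thesis by (simp add: rev_gegenbauer_coeff_def)
    next
      case 2
      then have "(of_nat (Suc k) :: 'a) = 2 * of_nat j"
        by (metis of_nat_mult of_nat_numeral)
      then show ?thesis using 2 by (simp add: rev_gegenbauer_coeff_def)
    next
      case 3
      then show ?thesis
        by (simp add: rev_gegenbauer_coeff_def pochhammer_Suc Suc_diff_le divide_simps)
          (simp add: algebra_simps)
    next
      case 4
      define a where
        "a = (- 1 / 4) ^ j * pochhammer c (Suc (j + n)) / (fact j * fact (Suc n))"
      have nz: "(of_nat n + 2 :: 'a) \<noteq> 0"
        using of_nat_neq_0[of "Suc n", where 'a = 'a] by (simp add: add.commute)
      have idx: "Suc k - j = Suc (Suc (j + n))" "Suc k - Suc j = Suc (j + n)"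
          "k - j = Suc (j + n)" "Suc k - 2 * j = Suc (Suc n)" "Suc k - 2 * Suc j = n"
          "k - 2 * j = Suc n"
        using 4 by simp_all
      have "(of_nat n + 2) * ?g (Suc k) j = (c + of_nat (Suc (j + n))) * a"
        unfolding rev_gegenbauer_coeff_def idx a_def pochhammer_Suc[of c "Suc (j + n)"]
          fact_Suc[of "Suc n"]
        using 4 nz by (simp add: add.commute)
      moreover have "2 * of_nat (Suc j) * ?g (Suc k) (Suc j) = - (of_nat (Suc n) / 2) * a"
        unfolding rev_gegenbauer_coeff_def idx a_def fact_Suc power_Suc
        using 4 by (simp add: field_simps del: of_nat_Suc)
      moreover have "?g k j = a"
        unfolding rev_gegenbauer_coeff_def idx a_def using 4 by simp
      moreover have "of_nat (Suc k) * ?g (Suc k) j - 2 * of_nat j * ?g (Suc k) j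
          = (of_nat n + 2) * ?g (Suc k) j"
        using 4 by (simp add: algebra_simps)
      ultimately show ?thesis
        using 4 by (simp add: field_simps)
    qed
  qed
  have deriv: "coeff ([:- 1, 1:] * pderiv (rev_gegenbauer c (Suc k))) j
      = of_nat j * ?g (Suc k) j - of_nat (Suc j) * ?g (Suc k) (Suc j)"
    by (cases j) (simp_all add: coeff_pderiv)
  show "coeff (smult (of_nat (Suc k)) (rev_gegenbauer c (Suc k))
     - smult 2 ([:- 1, 1:] * pderiv (rev_gegenbauer c (Suc k)))) j =
   coeff (smult ((of_nat k + 2 * c) / 2) (rev_gegenbauer c k)) j"
    unfolding coeff_diff coeff_smult deriv coeff_rev_gegenbauer key[symmetric]
    by (simp add: algebra_simps)
qed

section \<open>Roots\<close>

lemma poly_rev_gegenbauer_at_1: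
  "poly (rev_gegenbauer c k) 1 = pochhammer (2 * c) k / (2 ^ k * fact k)"
proof (induction k rule: induct_nat_012)
  case (ge2 k)
  have nz: "(of_nat k + 2 :: 'a) \<noteq> 0" "(of_nat k + 1 :: 'a) \<noteq> 0"
    using of_nat_neq_0[of "Suc k", where 'a = 'a] of_nat_neq_0[of k, where 'a = 'a]
    by (simp_all add: add.commute)
  \<comment> \<open>The common factor of the values at \<open>k\<close>, \<open>k + 1\<close> and \<open>k + 2\<close>, chosen so that the cofactors
    are polynomials in \<open>k\<close> and \<open>c\<close>.\<close>
  define d where "d = pochhammer (2 * c) k / (2 ^ Suc (Suc k) * fact (Suc k))"
  have d0: "pochhammer (2 * c) k / (2 ^ k * fact k) = 4 * (of_nat k + 1) * d"
    using nz unfolding d_def power_Suc fact_Suc by (simp add: divide_simps add.commute)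
  have d1: "pochhammer (2 * c) (Suc k) / (2 ^ Suc k * fact (Suc k)) = 2 * (2 * c + of_nat k) * d"
    unfolding d_def pochhammer_Suc power_Suc by (simp add: field_simps del: of_nat_Suc fact_Suc)
  have "(of_nat k + 2) * poly (rev_gegenbauer c (Suc (Suc k))) 1 =
      (of_nat k + 1 + c) * poly (rev_gegenbauer c (Suc k)) 1
      - (of_nat k + 2 * c) / 4 * poly (rev_gegenbauer c k) 1"
    using arg_cong[OF rev_gegenbauer_recurrence[of k c], of "\<lambda>p. poly p 1"] by simp
  also have "\<dots> = (of_nat k + 1 + c) * (2 * (2 * c + of_nat k) * d)
      - (of_nat k + 2 * c) / 4 * (4 * (of_nat k + 1) * d)"
    unfolding ge2 d0 d1 ..
  also have "\<dots> = (2 * c + of_nat k) * (2 * c + of_nat (Suc k)) * d"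
    by (simp add: field_simps)
  also have "\<dots> = (of_nat k + 2) *
      (pochhammer (2 * c) (Suc (Suc k)) / (2 ^ Suc (Suc k) * fact (Suc (Suc k))))"
    using nz unfolding d_def pochhammer_Suc power_Suc fact_Suc
    by (simp add: add.commute) (simp add: mult_ac)
  finally show ?case unfolding mult_left_cancel[OF nz(1)] .
qed simp_all

lemma rev_gegenbauer_no_common_root:
  assumes "pochhammer c (Suc k) \<noteq> 0" "pochhammer (2 * c) (Suc k) \<noteq> 0"
    and "poly (rev_gegenbauer c (Suc k)) z = 0"
  shows "poly (rev_gegenbauer c k) z \<noteq> 0"
  using assms
proof (induction k)
  case (Suc k)
  show ?case
  proof
    assume root: "poly (rev_gegenbauer c (Suc k)) z = 0"
    have "z \<noteq> 0"
      using poly_rev_gegenbauer_at_0[of c "Suc (Suc k)"] Suc.prems by (auto simp del: fact_Suc)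
    moreover have "of_nat k + 2 * c \<noteq> 0"
      using Suc.prems(2) by (auto simp: pochhammer_Suc add.commute)
    moreover have "(of_nat k + 2 * c) / 4 * (z * poly (rev_gegenbauer c k) z) = 0"
      using arg_cong[OF rev_gegenbauer_recurrence[of k c], of "\<lambda>p. poly p z"]
      using root Suc.prems(3) by auto
    ultimately have "poly (rev_gegenbauer c k) z = 0"
      by simp
    moreover have "pochhammer c (Suc k) \<noteq> 0" "pochhammer (2 * c) (Suc k) \<noteq> 0"
      using Suc.prems pochhammer_neq_0_mono[of _ "Suc (Suc k)" "Suc k"] by auto
    ultimately show False
      using Suc.IH root by blast
  qed
qed simp

lemma rsquarefree_rev_gegenbauer:
  assumes "pochhammer c (Suc k) \<noteq> 0" "pochhammer (2 * c) (Suc k) \<noteq> 0"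
  shows "rsquarefree (rev_gegenbauer c (Suc k))"
  unfolding rsquarefree_roots
proof (intro allI notI, elim conjE)
  fix z assume root: "poly (rev_gegenbauer c (Suc k)) z = 0"
    and "poly (pderiv (rev_gegenbauer c (Suc k))) z = 0"
  then have "(of_nat k + 2 * c) / 2 * poly (rev_gegenbauer c k) z = 0"
    using arg_cong[OF rev_gegenbauer_pderiv[of k c], of "\<lambda>p. poly p z"] by simp
  moreover have "of_nat k + 2 * c \<noteq> 0"
    using assms(2) by (auto simp: pochhammer_Suc add.commute)
  ultimately show False
    using rev_gegenbauer_no_common_root[OF assms root] by simp
qed

lemma card_roots_rsquarefree:
  fixes p :: "complex poly"
  assumes "rsquarefree p"
  shows "card {z. poly p z = 0} = degree p"
proof -
  have "p \<noteq> 0" using assms by (auto simp: rsquarefree_def)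
  have "degree p = degree (smult (lead_coeff p) (\<Prod>z | poly p z = 0. [:- z, 1:]))"
    by (simp only: complex_poly_decompose_rsquarefree[OF assms])
  also have "\<dots> = card {z. poly p z = 0}"
    using \<open>p \<noteq> 0\<close> by (simp add: degree_prod_eq_sum_degree)
  finally show ?thesis by simp
qed

theorem lemma2p2:
  fixes c :: complex and k :: nat
  assumes "k > 0"
    and "pochhammer c k \<noteq> 0"
    and "pochhammer (2 * c) k \<noteq> 0"
  shows "(\<nexists>z. poly (P c k) z = 0 \<and> poly (P c (k - 1)) z = 0)
    \<and> card {z. poly (P c k) z = 0} = k div 2
    \<and> poly (P c k) 1 \<noteq> 0"
proof -
  have roots: "poly (P c n) z = 0 \<longleftrightarrow> poly (rev_gegenbauer c n) z = 0" if "n \<le> k" for n z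
  proof -
    have "pochhammer c n \<noteq> 0"
      using assms(2) that by (rule pochhammer_neq_0_mono)
    then show ?thesis
      by (simp add: P_eq_smult_rev_gegenbauer)
  qed
  obtain m where k: "k = Suc m"
    using assms(1) gr0_implies_Suc by blast
  have "poly (rev_gegenbauer c m) z \<noteq> 0" if "poly (rev_gegenbauer c k) z = 0" for z
    using rev_gegenbauer_no_common_root assms(2,3) that unfolding k by blast
  moreover have "card {z. poly (rev_gegenbauer c k) z = 0} = k div 2"
    using card_roots_rsquarefree[OF rsquarefree_rev_gegenbauer] degree_rev_gegenbauer assms(2,3)
    unfolding k by metis
  moreover have "poly (rev_gegenbauer c k) 1 \<noteq> 0"
    using assms(3) by (simp add: poly_rev_gegenbauer_at_1)
  ultimately show ?thesis
    using k by (auto simp: roots)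
qed

end
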